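(* For all integers $0\le r\le n$ and every matroid $\mathsf{M}\in\overline{\mathcal{M}}_{r,n}$, the point $\overline{p}_{\mathsf{M}}$ is a vertex of $\overline{\Omega}_{r,n}$.
   Context: For integers $0\le r\le n$, $\overline{\mathcal{M}}_{r,n}$ is the set of matroids with ground set $[n]=\{1,\dots,n\}$ and rank $r$. The base polytope $\mathscr{P}(\mathsf{M})\subseteq\mathbb{R}^n$ is the convex hull of the $0/1$ indicator vectors of the bases of $\mathsf{M}$; $\mathbf{1}_X$ is the indicator function of $X\subseteq\mathbb{R}^n$. A Schubert matroid is a matroid whose lattice of cyclic flats is a chain; $\overline{\mathcal{S}}_{r,n}\subseteq\overline{\mathcal{M}}_{r,n}$ is the set of Schubert matroids. For each $\mathsf{M}\in\overline{\mathcal{M}}_{r,n}$ there are unique integers $a_{\mathsf{S}}(\mathsf{M})$ ($\mathsf{S}\in\overline{\mathcal{S}}_{r,n}$) with $\mathbf{1}_{\mathscr{P}(\mathsf{M})}=\sum_{\mathsf{S}}a_{\mathsf{S}}(\mathsf{M})\mathbf{1}_{\mathscr{P}(\mathsf{S})}$; let $\overline{p}_{\mathsf{M}}=(a_{\mathsf{S}}(\mathsf{M}))_{\mathsf{S}}\in\mathbb{Z}^{\overline{\mathcal{S}}_{r,n}}$ and $\overline{\Omega}_{r,n}=\operatorname{conv}\{\overline{p}_{\mathsf{M}}:\mathsf{M}\in\overline{\mathcal{M}}_{r,n}\}\subseteq\mathbb{R}^{\overline{\mathcal{S}}_{r,n}}$. *)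

theory Defs
  imports "HOL-Analysis.Analysis" "HOL-Analysis.Finite_Function_Topology"
begin

text \<open>
  A matroid is represented by its set of bases. The rank \<open>r\<close> and the ground set \<open>{1..n}\<close> are
  parameters, since elements that lie in no basis (loops) cannot be recovered from the bases.
\<close>

type_synonym bases = "nat set set"

definition matroids :: "nat \<Rightarrow> nat \<Rightarrow> bases set" where
  "matroids r n = {M.
     M \<noteq> {} \<and>
     (\<forall>B\<in>M. B \<subseteq> {1..n} \<and> card B = r) \<and>
     (\<forall>A\<in>M. \<forall>B\<in>M. \<forall>x\<in>A - B. \<exists>y\<in>B - A. insert y (A - {x}) \<in> M)}"

definition independent_in :: "bases \<Rightarrow> nat set \<Rightarrow> bool" where
  "independent_in M A \<longleftrightarrow> (\<exists>B\<in>M. A \<subseteq> B)"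

definition rank_of :: "bases \<Rightarrow> nat set \<Rightarrow> nat" where
  "rank_of M A = Max ((\<lambda>B. card (A \<inter> B)) ` M)"

definition circuits :: "nat \<Rightarrow> bases \<Rightarrow> nat set set" where
  "circuits n M =
     {C. C \<subseteq> {1..n} \<and> \<not> independent_in M C \<and> (\<forall>D. D \<subset> C \<longrightarrow> independent_in M D)}"

definition flats :: "nat \<Rightarrow> bases \<Rightarrow> nat set set" where
  "flats n M =
     {F. F \<subseteq> {1..n} \<and> (\<forall>e\<in>{1..n} - F. rank_of M F < rank_of M (insert e F))}"

text \<open>A flat is cyclic if it is a (possibly empty) union of circuits.\<close>

definition cyclic_flats :: "nat \<Rightarrow> bases \<Rightarrow> nat set set" where
  "cyclic_flats n M = {F \<in> flats n M. \<exists>\<C>\<subseteq>circuits n M. F = \<Union>\<C>}"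

definition schubert_matroids :: "nat \<Rightarrow> nat \<Rightarrow> bases set" where
  "schubert_matroids r n = {M \<in> matroids r n. chain\<^sub>\<subseteq> (cyclic_flats n M)}"

text \<open>
  Since \<open>n\<close> is a term variable that may be \<open>0\<close>, the space $\mathbb{R}^n$ is taken as the coordinate
  subspace of \<open>nat \<Rightarrow>\<^sub>0 real\<close> of vectors with support in \<open>{1..n}\<close>.
  Likewise, the space of real vectors indexed by \<open>schubert_matroids r n\<close> is a coordinate subspace
  of \<open>bases \<Rightarrow>\<^sub>0 real\<close>.
\<close>

definition indicator_vec :: "nat set \<Rightarrow> (nat \<Rightarrow>\<^sub>0 real)" where
  "indicator_vec B = (\<Sum>i\<in>B. Poly_Mapping.single i 1)"

definition base_polytope :: "bases \<Rightarrow> (nat \<Rightarrow>\<^sub>0 real) set" where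
  "base_polytope M = convex hull (indicator_vec ` M)"

text \<open>
  Integers \<open>a\<close> satisfying the identity of indicator functions exist and are unique on
  \<open>schubert_matroids r n\<close>, so the choice operator selects the coefficients of \<open>M\<close> there; values of
  \<open>a\<close> elsewhere are never used. Requiring the identity at all \<open>x\<close>, and not only at those in
  $\mathbb{R}^n$, makes no difference, as both sides vanish off that subspace.
\<close>

definition schubert_coeff :: "nat \<Rightarrow> nat \<Rightarrow> bases \<Rightarrow> bases \<Rightarrow> int" where
  "schubert_coeff r n M = (SOME a. \<forall>x.
     indicator (base_polytope M) x =
       (\<Sum>S\<in>schubert_matroids r n. a S * indicator (base_polytope S) x))"

definition schubert_point :: "nat \<Rightarrow> nat \<Rightarrow> bases \<Rightarrow> (bases \<Rightarrow>\<^sub>0 real)" where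
  "schubert_point r n M =
     (\<Sum>S\<in>schubert_matroids r n. Poly_Mapping.single S (of_int (schubert_coeff r n M S)))"

definition Omega_polytope :: "nat \<Rightarrow> nat \<Rightarrow> (bases \<Rightarrow>\<^sub>0 real) set" where
  "Omega_polytope r n = convex hull (schubert_point r n ` matroids r n)"

end

theory Submission
  imports Defs
begin

text \<open>
  By the decomposition of its indicator function, the point of \<open>N\<close> determines, through linear
  functionals, which subsets of \<open>{1..n}\<close> are bases of \<open>N\<close>. Adding these functionals with sign
  \<open>+1\<close> for the bases of \<open>M\<close> and \<open>-1\<close> otherwise gives a functional maximized by \<open>M\<close> alone.

  The decomposition comes from the description of the base polytope by the inequalities
  \<open>x(A) \<le> rank A\<close> on the hypersimplex. If \<open>V\<close> is the set of all \<open>A\<close> violating theirs at \<open>x\<close>, then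
  submodularity makes the order complex of \<open>V\<close> contractible unless \<open>V\<close> is empty, so the signed
  count of the chains in \<open>V\<close> is the indicator of \<open>V = {}\<close>. By inclusion--exclusion this is an integer
  combination of the indicators of \<open>E \<inter> V = {}\<close> for chains \<open>E\<close>, and the inequalities of a chain \<open>E\<close>
  cut out the base polytope of a Schubert matroid.
\<close>

section \<open>Alternating sums over set families and chains\<close>

text \<open>Toggling the element \<open>w D\<close> changes the cardinality by one, and as
  \<open>w\<close> keeps its value on the toggled set, toggling twice restores \<open>D\<close>.
  This sign-reversing involution makes the sum equal to its own negative.\<close>

lemma alternating_sum_toggle:
  fixes w :: "'a set \<Rightarrow> 'a"
  assumes fin: "\<And>D. D \<in> \<D> \<Longrightarrow> finite D"
    and closed: "\<And>D. D \<in> \<D> \<Longrightarrow> sym_diff D {w D} \<in> \<D>"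
    and inv: "\<And>D. D \<in> \<D> \<Longrightarrow> w (sym_diff D {w D}) = w D"
  shows "(\<Sum>D\<in>\<D>. (-1::int) ^ card D) = 0"
proof -
  have sgn: "(-1::int) ^ card (sym_diff D {w D}) = - ((-1) ^ card D)" if "D \<in> \<D>" for D
  proof (cases "w D \<in> D")
    case True
    then have "sym_diff D {w D} = D - {w D}" by auto
    moreover have "card D = Suc (card (D - {w D}))"
      using True fin[OF that] by (metis card_Suc_Diff1)
    ultimately show ?thesis by simp
  next
    case False
    then have "sym_diff D {w D} = insert (w D) D" by auto
    then show ?thesis using False fin[OF that] by simp
  qed
  have invol: "sym_diff (sym_diff D {w D}) {w (sym_diff D {w D})} = D" if "D \<in> \<D>" for D
    using inv[OF that] by auto
  have "(\<Sum>D\<in>\<D>. (-1::int) ^ card D) = (\<Sum>D\<in>\<D>. - ((-1) ^ card D))"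
    by (rule sum.reindex_bij_witness[where i = "\<lambda>D. sym_diff D {w D}"
          and j = "\<lambda>D. sym_diff D {w D}"])
       (use invol closed sgn in auto)
  then show ?thesis by (simp add: sum_negf)
qed

lemma alternating_sum_Pow:
  assumes "finite K"
  shows "(\<Sum>E\<in>Pow K. (-1::int) ^ card E) = of_bool (K = {})"
proof (cases "K = {}")
  case False
  then obtain k where "k \<in> K" by auto
  have "(\<Sum>E\<in>Pow K. (-1::int) ^ card E) = 0"
    by (rule alternating_sum_toggle[where w = "\<lambda>_. k"])
       (use assms \<open>k \<in> K\<close> in \<open>auto intro: finite_subset\<close>)
  with False show ?thesis by simp
qed simp

lemma chain_subset_antimono:
  assumes "chain\<^sub>\<subseteq> F" "E \<subseteq> F"
  shows "chain\<^sub>\<subseteq> E"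
  unfolding chain_subset_def
proof (intro ballI)
  fix A B assume "A \<in> E" "B \<in> E"
  then have "A \<in> F" "B \<in> F" using assms(2) by auto
  then show "A \<subseteq> B \<or> B \<subseteq> A" using assms(1) by (simp add: chain_subset_def)
qed

text \<open>The toggled set lies between the largest member of the chain not containing \<open>m\<close> and
  the next member.\<close>

lemma alternating_sum_chains:
  fixes V :: "'a set set"
  assumes "finite V" and "m \<in> V" and V: "\<And>A. A \<in> V \<Longrightarrow> A \<union> m \<in> V"
  shows "(\<Sum>D | D \<subseteq> V \<and> chain\<^sub>\<subseteq> D. (-1::int) ^ card D) = 0"
proof (rule alternating_sum_toggle)
  \<comment> \<open>If some member of \<open>D\<close> does not contain \<open>m\<close>, then
    \<open>u D\<close> is the largest such member; otherwise it is empty and the toggled set is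
    \<open>m\<close> itself.\<close>
  define u where "u D = \<Union>{A\<in>D. \<not> m \<subseteq> A}" for D :: "'a set set"
  fix D assume "D \<in> {D. D \<subseteq> V \<and> chain\<^sub>\<subseteq> D}"
  then have DV: "D \<subseteq> V" and chain: "\<forall>A\<in>D. \<forall>B\<in>D. A \<subseteq> B \<or> B \<subseteq> A"
    by (auto simp: chain_subset_def)
  show finD: "finite D" using DV \<open>finite V\<close> by (rule finite_subset)
  have "u D \<union> m \<in> V"
  proof (cases "{A\<in>D. \<not> m \<subseteq> A} = {}")
    case True
    then show ?thesis using \<open>m \<in> V\<close> unfolding u_def by (metis Sup_empty Un_empty_left)
  next
    case False
    have "u D \<in> {A\<in>D. \<not> m \<subseteq> A}" unfolding u_def
      by (rule Union_in_chain[where \<A> = UNIV])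
        (use False finD chain in \<open>simp_all add: subset_chain_def\<close>)
    then show ?thesis using V DV by auto
  qed
  \<comment> \<open>A member containing \<open>m\<close> cannot lie inside one that does not, so by
    comparability it contains all of those and hence \<open>u D\<close>.\<close>
  moreover have "\<forall>A\<in>D. A \<subseteq> u D \<union> m \<or> u D \<union> m \<subseteq> A"
    using chain unfolding u_def by blast
  ultimately have "insert (u D \<union> m) D \<in> {D. D \<subseteq> V \<and> chain\<^sub>\<subseteq> D}"
    using DV chain by (auto simp: chain_subset_def simp del: Un_subset_iff)
  then have ins: "insert (u D \<union> m) D \<subseteq> V" "chain\<^sub>\<subseteq> (insert (u D \<union> m) D)" by auto
  have sub: "sym_diff D {u D \<union> m} \<subseteq> insert (u D \<union> m) D" by blast
  show "sym_diff D {u D \<union> m} \<in> {D. D \<subseteq> V \<and> chain\<^sub>\<subseteq> D}"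
    using subset_trans[OF sub ins(1)] chain_subset_antimono[OF ins(2) sub] by (intro CollectI conjI)
  \<comment> \<open>The toggled set contains \<open>m\<close>, so toggling leaves the members from
    which \<open>u\<close> is computed unchanged.\<close>
  have "{A \<in> sym_diff D {u D \<union> m}. \<not> m \<subseteq> A} = {A\<in>D. \<not> m \<subseteq> A}" by auto
  then have "u (sym_diff D {u D \<union> m}) = u D" by (simp add: u_def)
  then show "u (sym_diff D {u D \<union> m}) \<union> m = u D \<union> m" by simp
qed

section \<open>The rank function\<close>

lemma matroid_basis:
  assumes "M \<in> matroids r n" "B \<in> M"
  shows "B \<subseteq> {1..n}" "card B = r" "finite B"
proof -
  show "B \<subseteq> {1..n}" "card B = r" using assms by (auto simp: matroids_def)
  then show "finite B" by (simp add: finite_subset)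
qed

lemma matroid_finite: "M \<in> matroids r n \<Longrightarrow> finite M"
  by (rule finite_subset[of _ "Pow {1..n}"]) (auto simp: matroids_def)

lemma finite_matroids: "finite (matroids r n)"
  by (rule finite_subset[of _ "Pow (Pow {1..n})"]) (auto simp: matroids_def)

lemma card_le_rank:
  assumes "M \<in> matroids r n" "B \<in> M"
  shows "card (A \<inter> B) \<le> rank_of M A"
  unfolding rank_of_def using matroid_finite[OF assms(1)] assms(2) by (intro Max_ge) auto

lemma rank_attained:
  assumes "M \<in> matroids r n"
  obtains B where "B \<in> M" "card (A \<inter> B) = rank_of M A"
proof -
  have "rank_of M A \<in> (\<lambda>B. card (A \<inter> B)) ` M"
    unfolding rank_of_def using matroid_finite[OF assms] assms
    by (intro Max_in) (auto simp: matroids_def)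
  then show thesis using that by auto
qed

text \<open>Among pairs of bases attaining the two ranks, take one with the largest intersection.
  Exchanging an element of \<open>B1 - B2\<close> outside \<open>X\<close>, or of
  \<open>B2 - B1\<close> outside \<open>Y\<close>, would keep the ranks attained and enlarge the
  intersection.\<close>

lemma rank_attained_nested:
  assumes M: "M \<in> matroids r n" and "X \<subseteq> Y"
  obtains B where "B \<in> M" "card (X \<inter> B) = rank_of M X" "card (Y \<inter> B) = rank_of M Y"
proof -
  define P where "P = {(B1, B2). B1 \<in> M \<and> B2 \<in> M \<and>
    card (X \<inter> B1) = rank_of M X \<and> card (Y \<inter> B2) = rank_of M Y}"
  have "P \<subseteq> M \<times> M" by (auto simp: P_def)
  then have "finite P" using matroid_finite[OF M] by (auto intro: finite_subset)
  define h where "h = (\<lambda>(C1, C2). card (C1 \<inter> C2 :: nat set))"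
  obtain C1 C2 where "C1 \<in> M" "card (X \<inter> C1) = rank_of M X" "C2 \<in> M" "card (Y \<inter> C2) = rank_of M Y"
    using rank_attained[OF M] by metis
  then have "P \<noteq> {}" by (auto simp: P_def)
  with \<open>finite P\<close> have "Max (h ` P) \<in> h ` P" by (intro Max_in) auto
  then obtain p where p: "p \<in> P" "h p = Max (h ` P)" by auto
  obtain B1 B2 where "p = (B1, B2)" by (cases p)
  have max: "card (C1 \<inter> C2) \<le> card (B1 \<inter> B2)" if "(C1, C2) \<in> P" for C1 C2
  proof -
    have "h (C1, C2) \<le> h p" using that \<open>finite P\<close> p by simp
    then show ?thesis by (simp add: h_def \<open>p = (B1, B2)\<close>)
  qed
  have B: "B1 \<in> M" "B2 \<in> M" "card (X \<inter> B1) = rank_of M X" "card (Y \<inter> B2) = rank_of M Y"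
    using p by (auto simp: P_def \<open>p = (B1, B2)\<close>)
  note f1 = matroid_basis[OF M B(1)] and f2 = matroid_basis[OF M B(2)]
  have exch: "\<And>A B x. A \<in> M \<Longrightarrow> B \<in> M \<Longrightarrow> x \<in> A - B \<Longrightarrow> \<exists>y\<in>B - A. insert y (A - {x}) \<in> M"
    using M unfolding matroids_def by blast
  have "B1 - B2 \<subseteq> X"
  proof (rule ccontr)
    assume "\<not> B1 - B2 \<subseteq> X"
    then obtain x where x: "x \<in> B1 - B2" "x \<notin> X" by auto
    from exch[OF B(1,2) x(1)] obtain y where y: "y \<in> B2 - B1" "insert y (B1 - {x}) \<in> M" by auto
    have "X \<inter> B1 \<subseteq> X \<inter> insert y (B1 - {x})" using x by auto
    then have "rank_of M X \<le> card (X \<inter> insert y (B1 - {x}))"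
      using B(3) f1(3) by (metis card_mono finite_Diff finite_Int finite_insert)
    with card_le_rank[OF M y(2), of X] have "(insert y (B1 - {x}), B2) \<in> P"
      using B y by (auto simp: P_def)
    then have "card (insert y (B1 - {x}) \<inter> B2) \<le> card (B1 \<inter> B2)" by (rule max)
    moreover have "insert y (B1 - {x}) \<inter> B2 = insert y (B1 \<inter> B2)" using x y by auto
    ultimately show False using y f1(3) by auto
  qed
  moreover have "B2 - B1 \<subseteq> Y"
  proof (rule ccontr)
    assume "\<not> B2 - B1 \<subseteq> Y"
    then obtain x where x: "x \<in> B2 - B1" "x \<notin> Y" by auto
    from exch[OF B(2,1) x(1)] obtain y where y: "y \<in> B1 - B2" "insert y (B2 - {x}) \<in> M" by auto
    have "Y \<inter> B2 \<subseteq> Y \<inter> insert y (B2 - {x})" using x by auto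
    then have "rank_of M Y \<le> card (Y \<inter> insert y (B2 - {x}))"
      using B(4) f2(3) by (metis card_mono finite_Diff finite_Int finite_insert)
    with card_le_rank[OF M y(2), of Y] have "(B1, insert y (B2 - {x})) \<in> P"
      using B y by (auto simp: P_def)
    then have "card (B1 \<inter> insert y (B2 - {x})) \<le> card (B1 \<inter> B2)" by (rule max)
    moreover have "B1 \<inter> insert y (B2 - {x}) = insert y (B1 \<inter> B2)" using x y by auto
    ultimately show False using y f1(3) by auto
  qed
  \<comment> \<open>Both differences lie in \<open>Y\<close>, so the bases agree outside
    \<open>Y\<close>. Having equal size, they meet \<open>Y\<close> equally often, and
    \<open>B1\<close> serves for both sets.\<close>
  ultimately have eq: "B1 - Y = B2 - Y" using \<open>X \<subseteq> Y\<close> by auto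
  have "card (Y \<inter> B) + card (B - Y) = card B" if "finite B" for B
    using card_Int_Diff[OF that, of Y] by (simp add: Int_commute)
  then have "card (Y \<inter> B1) = card (Y \<inter> B2)"
    using eq f1 f2 by (metis add_right_cancel)
  then show thesis using that B by auto
qed

text \<open>A single basis attains the ranks of both \<open>X \<inter> Y\<close> and
  \<open>X \<union> Y\<close>; on its traces cardinality is modular, and the traces on
  \<open>X\<close> and \<open>Y\<close> are bounded by the ranks.\<close>

lemma rank_submodular:
  assumes M: "M \<in> matroids r n"
  shows "rank_of M (X \<union> Y) + rank_of M (X \<inter> Y) \<le> rank_of M X + rank_of M Y"
proof -
  obtain B where B: "B \<in> M" "card ((X \<inter> Y) \<inter> B) = rank_of M (X \<inter> Y)"
      "card ((X \<union> Y) \<inter> B) = rank_of M (X \<union> Y)"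
    using rank_attained_nested[OF M, of "X \<inter> Y" "X \<union> Y"] by blast
  have "card (X \<inter> B) + card (Y \<inter> B) = card ((X \<inter> B) \<union> (Y \<inter> B)) + card ((X \<inter> B) \<inter> (Y \<inter> B))"
    using matroid_basis(3)[OF M B(1)] by (intro card_Un_Int) auto
  moreover have "(X \<inter> B) \<union> (Y \<inter> B) = (X \<union> Y) \<inter> B" "(X \<inter> B) \<inter> (Y \<inter> B) = (X \<inter> Y) \<inter> B" by auto
  ultimately show ?thesis
    using B card_le_rank[OF M B(1), of X] card_le_rank[OF M B(1), of Y] by simp
qed

lemma rank_independent:
  assumes M: "M \<in> matroids r n" and "finite A" "independent_in M A"
  shows "card A \<le> rank_of M A"
  using assms card_le_rank[OF M, of _ A] unfolding independent_in_def by (metis Int_absorb2)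

lemma rank_dependent:
  assumes M: "M \<in> matroids r n" and "finite A" "\<not> independent_in M A"
  shows "rank_of M A < card A"
proof -
  obtain B where B: "B \<in> M" "card (A \<inter> B) = rank_of M A" using rank_attained[OF M] .
  then have "A \<inter> B \<subset> A" using assms(3) by (auto simp: independent_in_def)
  then show ?thesis using B \<open>finite A\<close> by (metis psubset_card_mono)
qed

section \<open>Matroids cut out by a chain of rank conditions\<close>

text \<open>Two kinds of families occur: chains, which give Schubert matroids when the result is
  nonempty, and all subsets of \<open>{1..n}\<close> with the rank function of a matroid, which give
  that matroid back.\<close>

definition bounded_bases :: "nat \<Rightarrow> nat \<Rightarrow> nat set set \<Rightarrow> (nat set \<Rightarrow> nat) \<Rightarrow> bases" where
  "bounded_bases r n \<E> g = {B. B \<subseteq> {1..n} \<and> card B = r \<and> (\<forall>A\<in>\<E>. card (A \<inter> B) \<le> g A)}"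

text \<open>Exchanging \<open>x\<close> for \<open>y\<close> can only break a constraint that is
  tight for \<open>B1\<close>, contains \<open>y\<close> and omits \<open>x\<close>. In a chain the
  tight sets omitting \<open>x\<close> have a largest member if there are any, and it suffices to
  find \<open>y\<close> outside it.\<close>

lemma bounded_bases_in_matroids:
  assumes sub: "\<E> \<subseteq> Pow {1..n}" and chain: "chain\<^sub>\<subseteq> \<E>" and ne: "bounded_bases r n \<E> g \<noteq> {}"
  shows "bounded_bases r n \<E> g \<in> matroids r n"
proof -
  have "\<exists>y\<in>B2 - B1. insert y (B1 - {x}) \<in> bounded_bases r n \<E> g"
    if B1: "B1 \<in> bounded_bases r n \<E> g" and B2: "B2 \<in> bounded_bases r n \<E> g" and x: "x \<in> B1 - B2"
    for B1 B2 x
  proof -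
    have f: "finite B1" "finite B2" "card B1 = r" "card B2 = r" "B1 \<subseteq> {1..n}" "B2 \<subseteq> {1..n}"
      using B1 B2 by (auto simp: bounded_bases_def intro: finite_subset)
    define \<T> where "\<T> = {A\<in>\<E>. card (A \<inter> B1) = g A \<and> x \<notin> A}"
    define T where "T = \<Union>\<T>"
    have fin: "finite \<T>" using sub by (auto simp: \<T>_def intro: finite_subset)
    have T: "T = {} \<or> T \<in> \<T>"
    proof (cases "\<T> = {}")
      case False
      have "T \<in> \<T>" unfolding T_def
        by (rule Union_in_chain[where \<A> = UNIV, OF fin False])
          (use chain in \<open>simp add: subset_chain_def chain_subset_def \<T>_def\<close>)
      then show ?thesis by simp
    qed (simp add: T_def)
    have xT: "x \<notin> T" by (auto simp: T_def \<T>_def)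
    \<comment> \<open>Otherwise \<open>B2 - T\<close> would be contained in \<open>B1 - T\<close>,
      while tightness of \<open>T\<close> makes it at least as large. The two would coincide,
      although \<open>x\<close> lies only in \<open>B1 - T\<close>.\<close>
    have "\<not> B2 - B1 \<subseteq> T"
    proof
      assume *: "B2 - B1 \<subseteq> T"
      have "card (T \<inter> B2) \<le> card (T \<inter> B1)"
        using T B2 by (auto simp: \<T>_def bounded_bases_def)
      moreover have "card (T \<inter> B) + card (B - T) = card B" if "finite B" for B
        using card_Int_Diff[OF that, of T] by (simp add: Int_commute)
      ultimately have "card (B1 - T) \<le> card (B2 - T)" using f
        by (metis add_le_cancel_right add_le_mono1 nat_add_left_cancel_le)
      moreover have "B2 - T \<subseteq> B1 - T" using * by auto
      ultimately have "B2 - T = B1 - T" using f by (metis card_seteq finite_Diff)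
      with x xT show False by auto
    qed
    then obtain y where y: "y \<in> B2 - B1" "y \<notin> T" by auto
    have "insert y (B1 - {x}) \<in> bounded_bases r n \<E> g"
    proof -
      have "card (A \<inter> insert y (B1 - {x})) \<le> g A" if A: "A \<in> \<E>" for A
      proof -
        have le: "card (A \<inter> B1) \<le> g A" using A B1 by (auto simp: bounded_bases_def)
        consider "y \<notin> A" | "y \<in> A" "x \<in> A" | "y \<in> A" "x \<notin> A" by auto
        then show ?thesis
        proof cases
          case 1
          then have "A \<inter> insert y (B1 - {x}) \<subseteq> A \<inter> B1" by auto
          then show ?thesis using le f by (meson card_mono finite_Int le_trans)
        next
          case 2
          then have "A \<inter> insert y (B1 - {x}) = insert y ((A \<inter> B1) - {x})" by auto
          moreover have "card (insert y ((A \<inter> B1) - {x})) = card (A \<inter> B1)"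
            using 2 x y f by (simp add: card_Suc_Diff1 del: card_Diff_insert card_Diff_singleton)
          ultimately show ?thesis using le by simp
        next
          case 3
          then have "A \<notin> \<T>" using y by (auto simp: T_def)
          then have "card (A \<inter> B1) < g A" using A 3 le by (auto simp: \<T>_def)
          moreover have "card (A \<inter> insert y (B1 - {x})) \<le> card (insert y (A \<inter> B1))"
            using f(1) by (intro card_mono) auto
          moreover have "card (insert y (A \<inter> B1)) = Suc (card (A \<inter> B1))"
            using f(1) y by auto
          ultimately show ?thesis by simp
        qed
      qed
      moreover have "card (insert y (B1 - {x})) = r"
        using x y f by (simp add: card_Suc_Diff1 del: card_Diff_insert card_Diff_singleton)
      ultimately show ?thesis using x y f by (auto simp: bounded_bases_def)
    qed
    with y show ?thesis by auto
  qed
  then show ?thesis using ne unfolding matroids_def by (auto simp: bounded_bases_def)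
qed

text \<open>Every constraint set that gains \<open>b\<close> loses \<open>a\<close>, so no bounded
  count grows.\<close>

lemma bounded_bases_replace:
  assumes B: "B \<in> bounded_bases r n \<E> g" and "a \<in> B" "b \<notin> B" "b \<in> {1..n}"
    and ab: "\<And>A. A \<in> \<E> \<Longrightarrow> b \<in> A \<Longrightarrow> a \<in> A"
  shows "insert b (B - {a}) \<in> bounded_bases r n \<E> g"
proof -
  have f: "finite B" "card B = r" using B by (auto simp: bounded_bases_def intro: finite_subset)
  have "card (A \<inter> insert b (B - {a})) \<le> g A" if A: "A \<in> \<E>" for A
  proof -
    have le: "card (A \<inter> B) \<le> g A" using A B by (auto simp: bounded_bases_def)
    show ?thesis
    proof (cases "b \<in> A")
      case True
      then have "A \<inter> insert b (B - {a}) = insert b ((A \<inter> B) - {a})" by auto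
      moreover have "card (insert b ((A \<inter> B) - {a})) = card (A \<inter> B)"
        using True ab[OF A True] assms(2,3) f
        by (simp add: card_Suc_Diff1 del: card_Diff_insert card_Diff_singleton)
      ultimately show ?thesis using le by simp
    next
      case False
      then have "A \<inter> insert b (B - {a}) \<subseteq> A \<inter> B" by auto
      then show ?thesis using le f by (meson card_mono finite_Int le_trans)
    qed
  qed
  moreover have "card (insert b (B - {a})) = r"
    using assms(2,3) f by (simp add: card_Suc_Diff1 del: card_Diff_insert card_Diff_singleton)
  ultimately show ?thesis using B assms(2-4) by (auto simp: bounded_bases_def)
qed

text \<open>Take a circuit \<open>C\<close> in \<open>F\<close> through \<open>b\<close>. If
  \<open>a\<close> were outside \<open>F\<close>, putting \<open>a\<close> in place of
  \<open>b\<close> in \<open>C\<close> would give a dependent set, since a basis containing it would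
  contain \<open>C\<close> or could be changed into one that does. Then \<open>C - {b}\<close> spans
  \<open>a\<close>, contradicting that \<open>F\<close> is a flat.\<close>

lemma bounded_bases_cyclic_flat_closed:
  assumes M: "bounded_bases r n \<E> g \<in> matroids r n"
    and F: "F \<in> cyclic_flats n (bounded_bases r n \<E> g)" and "b \<in> F" "a \<in> {1..n}"
    and ab: "\<And>A. A \<in> \<E> \<Longrightarrow> b \<in> A \<Longrightarrow> a \<in> A"
  shows "a \<in> F"
proof (rule ccontr)
  let ?M = "bounded_bases r n \<E> g"
  assume "a \<notin> F"
  then have lt: "rank_of ?M F < rank_of ?M (insert a F)"
    using F \<open>a \<in> {1..n}\<close> by (auto simp: cyclic_flats_def flats_def)
  obtain C where C: "C \<in> circuits n ?M" "b \<in> C" "C \<subseteq> F"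
    using F \<open>b \<in> F\<close> by (auto simp: cyclic_flats_def)
  then have Cn: "C \<subseteq> {1..n}" and dep: "\<not> independent_in ?M C"
    and ind: "independent_in ?M (C - {b})"
    by (auto simp: circuits_def)
  have fC: "finite C" using Cn by (rule finite_subset) simp
  have aC: "a \<notin> C" using C \<open>a \<notin> F\<close> by auto
  have "\<not> independent_in ?M (insert a (C - {b}))"
  proof
    assume "independent_in ?M (insert a (C - {b}))"
    then obtain B where B: "B \<in> ?M" "insert a (C - {b}) \<subseteq> B" by (auto simp: independent_in_def)
    show False
    proof (cases "b \<in> B")
      case True
      then have "C \<subseteq> B" using B by auto
      then show False using dep B by (auto simp: independent_in_def)
    next
      case False
      have "insert b (B - {a}) \<in> ?M"
        by (rule bounded_bases_replace[OF B(1)]) (use B False C Cn ab in auto)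
      moreover have "C \<subseteq> insert b (B - {a})" using B aC by auto
      ultimately show False using dep by (auto simp: independent_in_def)
    qed
  qed
  then have "rank_of ?M (insert a (C - {b})) < card (insert a (C - {b}))"
    using rank_dependent[OF M] fC by auto
  moreover have "card (insert a (C - {b})) = Suc (card (C - {b}))" using fC aC by auto
  moreover have "card (C - {b}) \<le> rank_of ?M (C - {b})"
    using rank_independent[OF M _ ind] fC by auto
  \<comment> \<open>With these as union and intersection, submodularity bounds the rank of
    \<open>insert a F\<close> by that of \<open>F\<close>.\<close>
  moreover have "insert a (C - {b}) \<union> F = insert a F" "insert a (C - {b}) \<inter> F = C - {b}"
    using C \<open>a \<notin> F\<close> by auto
  ultimately show False using rank_submodular[OF M, of "insert a (C - {b})" F] lt by simp
qed

text \<open>Two incomparable cyclic flats would provide elements \<open>a\<close> and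
  \<open>b\<close> and, by the closure property, one constraint set containing only \<open>b\<close>
  and another containing only \<open>a\<close>. Such sets are incomparable.\<close>

lemma bounded_bases_schubert:
  assumes sub: "\<E> \<subseteq> Pow {1..n}" and chain: "chain\<^sub>\<subseteq> \<E>" and ne: "bounded_bases r n \<E> g \<noteq> {}"
  shows "bounded_bases r n \<E> g \<in> schubert_matroids r n"
proof -
  have M: "bounded_bases r n \<E> g \<in> matroids r n" by (rule bounded_bases_in_matroids[OF assms])
  have "F \<subseteq> G \<or> G \<subseteq> F" if F: "F \<in> cyclic_flats n (bounded_bases r n \<E> g)"
    and G: "G \<in> cyclic_flats n (bounded_bases r n \<E> g)" for F G
  proof (rule ccontr)
    assume "\<not> (F \<subseteq> G \<or> G \<subseteq> F)"
    then obtain a b where ab: "a \<in> F" "a \<notin> G" "b \<in> G" "b \<notin> F" by auto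
    have n: "a \<in> {1..n}" "b \<in> {1..n}" using F G ab by (auto simp: cyclic_flats_def flats_def)
    obtain A where A: "A \<in> \<E>" "b \<in> A" "a \<notin> A"
      using bounded_bases_cyclic_flat_closed[OF M G ab(3) n(1)] ab by auto
    obtain A' where A': "A' \<in> \<E>" "a \<in> A'" "b \<notin> A'"
      using bounded_bases_cyclic_flat_closed[OF M F ab(1) n(2)] ab by auto
    show False using A A' chain unfolding chain_subset_def by blast
  qed
  then show ?thesis using M by (auto simp: schubert_matroids_def chain_subset_def)
qed

section \<open>Integral rank polytopes\<close>

lemma lookup_scaleR [simp]:
  "Poly_Mapping.lookup (c *\<^sub>R x) i = c *\<^sub>R Poly_Mapping.lookup x i"
proof -
  have "finite {j. c *\<^sub>R Poly_Mapping.lookup x j \<noteq> 0}"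
    by (rule finite_subset[of _ "{j. Poly_Mapping.lookup x j \<noteq> 0}"]) auto
  then show ?thesis by (simp add: scaleR_poly_mapping_def lookup_Abs_poly_mapping)
qed

abbreviation coord :: "(nat \<Rightarrow>\<^sub>0 real) \<Rightarrow> nat \<Rightarrow> real" where
  "coord \<equiv> Poly_Mapping.lookup"

definition weight :: "(nat \<Rightarrow>\<^sub>0 real) \<Rightarrow> nat set \<Rightarrow> real" where
  "weight x A = (\<Sum>i\<in>A. coord x i)"

lemma weight_add: "weight (x + y) A = weight x A + weight y A"
  by (simp add: weight_def lookup_add sum.distrib)

lemma weight_scaleR: "weight (c *\<^sub>R x) A = c * weight x A"
  by (simp add: weight_def sum_distrib_left)

lemma coord_indicator_vec:
  assumes "finite B"
  shows "coord (indicator_vec B) i = of_bool (i \<in> B)"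
  using assms by (simp add: indicator_vec_def lookup_sum lookup_single when_def of_bool_def)

lemma weight_indicator_vec:
  assumes "finite A" "finite B"
  shows "weight (indicator_vec B) A = real (card (A \<inter> B))"
  using assms by (simp add: weight_def coord_indicator_vec of_bool_def sum.If_cases Int_def)

text \<open>This is a hypersimplex cut by upper bounds on weights. The bounds are natural numbers,
  so that tight sets have integral weight.\<close>

definition rank_polytope :: "nat \<Rightarrow> nat \<Rightarrow> nat set set \<Rightarrow> (nat set \<Rightarrow> nat) \<Rightarrow> (nat \<Rightarrow>\<^sub>0 real) set" where
  "rank_polytope r n \<F> g = {x. (\<forall>i. i \<notin> {1..n} \<longrightarrow> coord x i = 0) \<and>
     (\<forall>i. 0 \<le> coord x i \<and> coord x i \<le> 1) \<and> weight x {1..n} = r \<and> (\<forall>A\<in>\<F>. weight x A \<le> g A)}"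

lemma convex_rank_polytope: "convex (rank_polytope r n \<F> g)"
proof (rule convexI)
  fix x y :: "nat \<Rightarrow>\<^sub>0 real" and u v :: real
  assume *: "x \<in> rank_polytope r n \<F> g" "y \<in> rank_polytope r n \<F> g" "0 \<le> u" "0 \<le> v" "u + v = 1"
  have "weight (u *\<^sub>R x + v *\<^sub>R y) {1..n} = u * real r + v * real r"
    using * by (simp add: rank_polytope_def weight_add weight_scaleR)
  then have "weight (u *\<^sub>R x + v *\<^sub>R y) {1..n} = real r"
    using \<open>u + v = 1\<close> by (simp flip: distrib_right)
  then show "u *\<^sub>R x + v *\<^sub>R y \<in> rank_polytope r n \<F> g"
    using * by (auto simp: rank_polytope_def weight_add weight_scaleR lookup_add
        intro!: convex_bound_le add_nonneg_nonneg mult_nonneg_nonneg)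
qed

definition shift :: "nat \<Rightarrow> nat \<Rightarrow> real \<Rightarrow> (nat \<Rightarrow>\<^sub>0 real) \<Rightarrow> (nat \<Rightarrow>\<^sub>0 real)" where
  "shift i j t x = x + t *\<^sub>R (Poly_Mapping.single i 1 - Poly_Mapping.single j 1)"

lemma coord_shift:
  assumes "i \<noteq> j"
  shows "coord (shift i j t x) k = coord x k + (if k = i then t else if k = j then - t else 0)"
  using assms by (auto simp: shift_def lookup_add lookup_minus lookup_single)

lemma weight_shift:
  assumes "finite A"
  shows "weight (shift i j t x) A = weight x A + t * (of_bool (i \<in> A) - of_bool (j \<in> A))"
  using assms by (simp add: shift_def weight_def lookup_add lookup_minus sum.distrib
      sum_subtractf lookup_single when_def flip: sum_distrib_left)

text \<open>The sizes of this set and of \<open>slack\<close> add up to the measure for the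
  induction that proves integrality.\<close>

definition fractional :: "nat \<Rightarrow> (nat \<Rightarrow>\<^sub>0 real) \<Rightarrow> nat set" where
  "fractional n x = {i\<in>{1..n}. 0 < coord x i \<and> coord x i < 1}"

definition slack :: "nat set set \<Rightarrow> (nat set \<Rightarrow> nat) \<Rightarrow> (nat \<Rightarrow>\<^sub>0 real) \<Rightarrow> nat set set" where
  "slack \<F> g x = {A\<in>\<F>. weight x A < g A}"

text \<open>Mass is moved from \<open>j\<close> to \<open>i\<close> as far as the polytope allows.
  Tight sets contain both or neither and stay tight, and integral coordinates do not move; at the
  last feasible step a coordinate becomes integral or a slack constraint becomes tight.\<close>

lemma shift_to_boundary:
  assumes x: "x \<in> rank_polytope r n \<F> g" and \<F>: "\<F> \<subseteq> Pow {1..n}"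
    and ij: "i \<in> fractional n x" "j \<in> fractional n x" "i \<noteq> j"
    and tight: "\<And>A. A \<in> \<F> \<Longrightarrow> weight x A = g A \<Longrightarrow> i \<in> A \<longleftrightarrow> j \<in> A"
  obtains t where "t > 0" "shift i j t x \<in> rank_polytope r n \<F> g"
    "card (fractional n (shift i j t x)) + card (slack \<F> g (shift i j t x))
      < card (fractional n x) + card (slack \<F> g x)"
proof -
  \<comment> \<open>Only sets containing \<open>i\<close> but not \<open>j\<close> gain weight;
    their gaps, together with the distances of the two coordinates from 1 and 0, limit the
    step.\<close>
  define U where "U = (\<lambda>A. g A - weight x A) ` {A\<in>\<F>. i \<in> A \<and> j \<notin> A}"
  define t where "t = Min (insert (1 - coord x i) (insert (coord x j) U))"
  have fin: "finite \<F>" using \<F> by (rule finite_subset) simp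
  have finA: "finite A" if "A \<in> \<F>" for A using that \<F> by (auto intro: finite_subset)
  have finU: "finite U" using fin by (simp add: U_def)
  have le: "weight x A \<le> g A" if "A \<in> \<F>" for A using x that by (auto simp: rank_polytope_def)
  have pos: "u > 0" if "u \<in> insert (1 - coord x i) (insert (coord x j) U)" for u
    using that ij tight le by (force simp: U_def fractional_def)
  have t_in: "t \<in> insert (1 - coord x i) (insert (coord x j) U)"
    unfolding t_def using finU by (intro Min_in) auto
  then have "t > 0" by (rule pos)
  have t_le: "t \<le> u" if "u \<in> insert (1 - coord x i) (insert (coord x j) U)" for u
    unfolding t_def using finU that by (intro Min_le) auto
  let ?y = "shift i j t x"
  have wy: "weight ?y A = weight x A + t * (of_bool (i \<in> A) - of_bool (j \<in> A))" if "A \<in> \<F>" for A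
    by (rule weight_shift[OF finA[OF that]])
  have ly: "coord ?y k = coord x k + (if k = i then t else if k = j then - t else 0)" for k
    by (rule coord_shift[OF \<open>i \<noteq> j\<close>])
  have n: "i \<in> {1..n}" "j \<in> {1..n}" and fr: "0 < coord x i" "coord x i < 1" "0 < coord x j" "coord x j < 1"
    using ij by (auto simp: fractional_def)
  have ti: "t \<le> 1 - coord x i" and tj: "t \<le> coord x j" using t_le by auto
  have "?y \<in> rank_polytope r n \<F> g"
  proof -
    have "coord ?y k = 0" if "k \<notin> {1..n}" for k
      using that n x by (auto simp: ly rank_polytope_def)
    moreover have "0 \<le> coord ?y k \<and> coord ?y k \<le> 1" for k
      using fr ti tj \<open>t > 0\<close> x by (auto simp: ly rank_polytope_def)
    moreover have "weight ?y {1..n} = r"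
      using x n by (simp add: weight_shift rank_polytope_def)
    moreover have "weight ?y A \<le> g A" if A: "A \<in> \<F>" for A
    proof (cases "i \<in> A \<and> j \<notin> A")
      case True
      then have "t \<le> g A - weight x A" using A by (intro t_le) (auto simp: U_def)
      then show ?thesis using True by (simp add: wy[OF A])
    next
      case False
      then show ?thesis using \<open>t > 0\<close> le[OF A] by (auto simp: wy[OF A] of_bool_def)
    qed
    ultimately show ?thesis by (auto simp: rank_polytope_def)
  qed
  moreover have "card (fractional n ?y) + card (slack \<F> g ?y) < card (fractional n x) + card (slack \<F> g x)"
  proof -
    have s1: "fractional n ?y \<subseteq> fractional n x"
      using ij by (auto simp: fractional_def ly split: if_splits)
    have s2: "slack \<F> g ?y \<subseteq> slack \<F> g x"
    proof
      fix A assume "A \<in> slack \<F> g ?y"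
      then have A: "A \<in> \<F>" "weight ?y A < g A" by (auto simp: slack_def)
      then have "weight x A \<noteq> g A" using tight[OF A(1)] by (auto simp: wy[OF A(1)])
      then show "A \<in> slack \<F> g x" using A(1) le[OF A(1)] by (auto simp: slack_def)
    qed
    have f1: "finite (fractional n x)" by (simp add: fractional_def)
    have f2: "finite (slack \<F> g x)" using fin by (simp add: slack_def)
    have "fractional n ?y \<noteq> fractional n x \<or> slack \<F> g ?y \<noteq> slack \<F> g x"
    proof -
      consider "t = 1 - coord x i" | "t = coord x j"
        | A where "A \<in> \<F>" "i \<in> A" "j \<notin> A" "t = g A - weight x A"
        using t_in by (auto simp: U_def)
      then show ?thesis
      proof cases
        case 1
        then have "i \<notin> fractional n ?y" using ly[of i] by (simp add: fractional_def)
        then show ?thesis using ij by auto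
      next
        case 2
        then have "j \<notin> fractional n ?y" using ly[of j] \<open>i \<noteq> j\<close> by (simp add: fractional_def)
        then show ?thesis using ij by auto
      next
        case (3 A)
        then have "A \<notin> slack \<F> g ?y" using wy[of A] by (simp add: slack_def)
        moreover have "A \<in> slack \<F> g x" using 3 \<open>t > 0\<close> by (simp add: slack_def)
        ultimately show ?thesis by auto
      qed
    qed
    then consider "fractional n ?y \<subset> fractional n x" | "slack \<F> g ?y \<subset> slack \<F> g x"
      using s1 s2 by auto
    then show ?thesis
    proof cases
      case 1
      then show ?thesis using psubset_card_mono[OF f1] card_mono[OF f2 s2] by (simp add: add_less_le_mono)
    next
      case 2
      then show ?thesis using psubset_card_mono[OF f2] card_mono[OF f1 s1] by (simp add: add_le_less_mono)
    qed
  qed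
  ultimately show thesis using \<open>t > 0\<close> that by blast
qed

text \<open>Weights proportional to the opposite step lengths make the two displacements
  cancel.\<close>

lemma shift_convex_combination:
  assumes "s > 0" "t > 0" "convex K" "shift i j s x \<in> K" "shift j i t x \<in> K"
  shows "x \<in> K"
proof -
  have "(t / (s + t)) *\<^sub>R shift i j s x + (s / (s + t)) *\<^sub>R shift j i t x \<in> K"
    by (rule convexD[OF assms(3,4,5)]) (use assms in \<open>auto simp flip: add_divide_distrib\<close>)
  moreover have "(t / (s + t)) *\<^sub>R shift i j s x + (s / (s + t)) *\<^sub>R shift j i t x
    = (t / (s + t) + s / (s + t)) *\<^sub>R x"
    by (simp add: shift_def algebra_simps)
  moreover have "t / (s + t) + s / (s + t) = 1" using assms by (simp flip: add_divide_distrib)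
  ultimately show ?thesis by simp
qed

text \<open>A minimal tight set meeting the fractional coordinates contains two of them, since its
  weight is an integer; mass can be moved between these two in both directions.\<close>

lemma rank_polytope_integral:
  assumes \<F>: "\<F> \<subseteq> Pow {1..n}"
    and tight_Int: "\<And>x A B. x \<in> rank_polytope r n \<F> g \<Longrightarrow> A \<in> \<F> \<Longrightarrow> B \<in> \<F> \<Longrightarrow>
      weight x A = g A \<Longrightarrow> weight x B = g B \<Longrightarrow> A \<inter> B \<in> \<F> \<and> weight x (A \<inter> B) = g (A \<inter> B)"
    and x: "x \<in> rank_polytope r n \<F> g"
  shows "x \<in> convex hull (indicator_vec ` {B. B \<subseteq> {1..n} \<and> indicator_vec B \<in> rank_polytope r n \<F> g})"
  using x
proof (induction "card (fractional n x) + card (slack \<F> g x)" arbitrary: x rule: less_induct)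
  case (less x)
  let ?K = "convex hull (indicator_vec ` {B. B \<subseteq> {1..n} \<and> indicator_vec B \<in> rank_polytope r n \<F> g})"
  note x = less.prems
  have int: "coord x i = 0 \<or> coord x i = 1" if "i \<notin> fractional n x" for i
  proof -
    have "0 \<le> coord x i \<and> coord x i \<le> 1" "i \<notin> {1..n} \<longrightarrow> coord x i = 0"
      using x by (auto simp: rank_polytope_def)
    then show ?thesis using that by (auto simp: fractional_def)
  qed
  show ?case
  proof (cases "fractional n x = {}")
    case True
    define B where "B = {i\<in>{1..n}. coord x i = 1}"
    have "coord x i = coord (indicator_vec B) i" for i
    proof -
      have "coord x i = 0 \<or> coord x i = 1" "i \<notin> {1..n} \<longrightarrow> coord x i = 0"
        using int True x by (auto simp: rank_polytope_def)
      then show ?thesis by (auto simp: coord_indicator_vec B_def)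
    qed
    then have "x = indicator_vec B" by (intro poly_mapping_eqI)
    moreover have "B \<subseteq> {1..n}" by (auto simp: B_def)
    ultimately show ?thesis using x by (intro hull_inc) auto
  next
    case False
    \<comment> \<open>The set \<open>{1..n}\<close> always has the integral weight \<open>r\<close>,
      so some member of \<open>T\<close> meets the fractional coordinates even if no constraint is
      tight.\<close>
    define T where "T = insert {1..n} {A\<in>\<F>. weight x A = g A}"
    have T_Int: "A \<inter> B \<in> T" if "A \<in> T" "B \<in> T" for A B
    proof -
      have "A \<subseteq> {1..n}" "B \<subseteq> {1..n}" using that \<F> by (auto simp: T_def)
      then show ?thesis using that tight_Int[OF x, of A B]
        by (auto simp: T_def Int_absorb1 Int_absorb2)
    qed
    define P where "P A \<longleftrightarrow> A \<in> T \<and> A \<inter> fractional n x \<noteq> {}" for A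
    have "P {1..n}" using False by (auto simp: P_def T_def fractional_def)
    then obtain A where PA: "P A" and min: "\<And>B. P B \<Longrightarrow> card A \<le> card B"
      using exists_least_iff[of "\<lambda>k. \<exists>A. P A \<and> card A = k"] by (metis not_less)
    have A: "A \<subseteq> {1..n}" using PA \<F> by (auto simp: P_def T_def)
    then have finA: "finite A" by (rule finite_subset) simp
    have wA: "weight x A \<in> \<int>"
      using PA x by (auto simp: P_def T_def rank_polytope_def)
    obtain i where i: "i \<in> A" "i \<in> fractional n x" using PA by (auto simp: P_def)
    \<comment> \<open>A lone fractional coordinate would be the difference of the integral weight of
      \<open>A\<close> and a sum of integers.\<close>
    have "\<exists>j\<in>A. j \<noteq> i \<and> j \<in> fractional n x"
    proof (rule ccontr)
      assume *: "\<not> ?thesis"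
      have "coord x k \<in> \<int>" if "k \<in> A - {i}" for k
      proof -
        have "k \<notin> fractional n x" using * that by auto
        from int[OF this] show ?thesis by auto
      qed
      then have "(\<Sum>k\<in>A - {i}. coord x k) \<in> \<int>" by (rule Ints_sum)
      moreover have "weight x A = coord x i + (\<Sum>k\<in>A - {i}. coord x k)"
        unfolding weight_def using finA i(1) by (rule sum.remove)
      ultimately have "coord x i \<in> \<int>" using wA by (metis Ints_diff add_diff_cancel_right')
      then obtain z :: int where "coord x i = of_int z" by (auto elim: Ints_cases)
      then show False using i(2) by (auto simp: fractional_def)
    qed
    then obtain j where j: "j \<in> A" "j \<noteq> i" "j \<in> fractional n x" by auto
    \<comment> \<open>A tight set separating \<open>i\<close> from \<open>j\<close> would meet
      \<open>A\<close> in a smaller member of \<open>T\<close> that still contains a fractional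
      coordinate.\<close>
    have sep: "b \<in> B" if "B \<in> \<F>" "weight x B = g B" "a \<in> B" "{a, b} = {i, j}" for B a b
    proof (rule ccontr)
      assume "b \<notin> B"
      have "a \<in> A" "b \<in> A" "a \<in> fractional n x" using that i j by (auto simp: doubleton_eq_iff)
      then have "P (A \<inter> B)" using that T_Int[of A B] PA by (auto simp: P_def T_def)
      then have "card A \<le> card (A \<inter> B)" by (rule min)
      moreover have "A \<inter> B \<subset> A" using \<open>b \<in> A\<close> \<open>b \<notin> B\<close> by auto
      ultimately show False using finA by (meson psubset_card_mono not_le)
    qed
    have tight: "i \<in> B \<longleftrightarrow> j \<in> B" if "B \<in> \<F>" "weight x B = g B" for B
      using sep[OF that, of i j] sep[OF that, of j i] by (auto simp: insert_commute)
    obtain s where s: "s > 0" "shift i j s x \<in> ?K"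
      using shift_to_boundary[OF x \<F> i(2) j(3) _ tight] j(2) less.hyps by (metis (no_types, lifting))
    obtain t where t: "t > 0" "shift j i t x \<in> ?K"
      using shift_to_boundary[OF x \<F> j(3) i(2) _ tight[symmetric]] j(2) less.hyps by (metis (no_types, lifting))
    show ?thesis
      by (rule shift_convex_combination[OF s(1) t(1) convex_convex_hull s(2) t(2)])
  qed
qed

section \<open>Base polytopes as rank polytopes\<close>

lemma indicator_vec_in_rank_polytope:
  assumes "\<F> \<subseteq> Pow {1..n}"
  shows "{B. B \<subseteq> {1..n} \<and> indicator_vec B \<in> rank_polytope r n \<F> g} = bounded_bases r n \<F> g"
proof -
  have "indicator_vec B \<in> rank_polytope r n \<F> g \<longleftrightarrow> B \<in> bounded_bases r n \<F> g"
    if B: "B \<subseteq> {1..n}" for B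
  proof -
    have f: "finite B" using B by (rule finite_subset) simp
    have "weight (indicator_vec B) A = real (card (A \<inter> B))" if "A \<in> \<F>" for A
      using that assms f by (intro weight_indicator_vec) (auto intro: finite_subset)
    moreover have "weight (indicator_vec B) {1..n} = real (card B)"
      using B f by (simp add: weight_indicator_vec Int_absorb1)
    moreover have "\<forall>i. i \<notin> {1..n} \<longrightarrow> coord (indicator_vec B) i = 0"
      using B f by (auto simp: coord_indicator_vec)
    moreover have "\<forall>i. 0 \<le> coord (indicator_vec B) i \<and> coord (indicator_vec B) i \<le> 1"
      using f by (simp add: coord_indicator_vec)
    ultimately show ?thesis using B by (simp add: rank_polytope_def bounded_bases_def)
  qed
  then show ?thesis by (auto simp: bounded_bases_def)
qed

text \<open>The closure of tight sets under intersection is assumed abstractly to cover both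
  applications: it is immediate for chains and follows from submodularity for rank
  functions.\<close>

lemma base_polytope_bounded_bases:
  assumes \<F>: "\<F> \<subseteq> Pow {1..n}"
    and "\<And>x A B. x \<in> rank_polytope r n \<F> g \<Longrightarrow> A \<in> \<F> \<Longrightarrow> B \<in> \<F> \<Longrightarrow>
      weight x A = g A \<Longrightarrow> weight x B = g B \<Longrightarrow> A \<inter> B \<in> \<F> \<and> weight x (A \<inter> B) = g (A \<inter> B)"
  shows "base_polytope (bounded_bases r n \<F> g) = rank_polytope r n \<F> g"
proof
  show "base_polytope (bounded_bases r n \<F> g) \<subseteq> rank_polytope r n \<F> g"
    unfolding base_polytope_def indicator_vec_in_rank_polytope[OF \<F>, symmetric]
    by (rule hull_minimal) (auto intro: convex_rank_polytope)
  show "rank_polytope r n \<F> g \<subseteq> base_polytope (bounded_bases r n \<F> g)"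
    unfolding base_polytope_def indicator_vec_in_rank_polytope[OF \<F>, symmetric]
    using rank_polytope_integral[OF assms] by blast
qed

lemma base_polytope_chain:
  assumes "\<E> \<subseteq> Pow {1..n}" and chain: "chain\<^sub>\<subseteq> \<E>"
  shows "base_polytope (bounded_bases r n \<E> g) = rank_polytope r n \<E> g"
proof (rule base_polytope_bounded_bases[OF assms(1)])
  fix x A B
  assume *: "A \<in> \<E>" "B \<in> \<E>" "weight x A = g A" "weight x B = g B"
  then have "A \<subseteq> B \<or> B \<subseteq> A" using chain by (simp add: chain_subset_def)
  then show "A \<inter> B \<in> \<E> \<and> weight x (A \<inter> B) = g (A \<inter> B)"
    using * by (auto simp: Int_absorb1 Int_absorb2)
qed

lemma weight_modular:
  assumes "finite A" "finite B"
  shows "weight x (A \<union> B) + weight x (A \<inter> B) = weight x A + weight x B"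
  unfolding weight_def using assms by (rule sum.union_inter)

text \<open>The condition for the set \<open>B\<close> itself forces
  \<open>r \<le> rank_of M B\<close>, so some basis meets \<open>B\<close> in \<open>r\<close>
  elements and hence equals it.\<close>

lemma bounded_bases_rank:
  assumes M: "M \<in> matroids r n"
  shows "bounded_bases r n (Pow {1..n}) (rank_of M) = M"
proof
  show "M \<subseteq> bounded_bases r n (Pow {1..n}) (rank_of M)"
    using M card_le_rank[OF M] by (auto simp: bounded_bases_def matroids_def)
  show "bounded_bases r n (Pow {1..n}) (rank_of M) \<subseteq> M"
  proof
    fix B assume "B \<in> bounded_bases r n (Pow {1..n}) (rank_of M)"
    then have B: "B \<subseteq> {1..n}" "card B = r" and "card (B \<inter> B) \<le> rank_of M B"
      unfolding bounded_bases_def by blast+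
    then have "r \<le> rank_of M B" by simp
    have fB: "finite B" using B(1) by (rule finite_subset) simp
    obtain C where C: "C \<in> M" "card (B \<inter> C) = rank_of M B" using rank_attained[OF M] .
    have "B \<inter> C = B" using B C fB \<open>r \<le> rank_of M B\<close> by (intro card_seteq) auto
    moreover have "B \<inter> C = C"
      using \<open>r \<le> rank_of M B\<close> C matroid_basis[OF M C(1)] by (intro card_seteq) auto
    ultimately show "B \<in> M" using C by simp
  qed
qed

lemma base_polytope_matroid:
  assumes M: "M \<in> matroids r n"
  shows "base_polytope M = rank_polytope r n (Pow {1..n}) (rank_of M)"
proof -
  have "base_polytope (bounded_bases r n (Pow {1..n}) (rank_of M))
    = rank_polytope r n (Pow {1..n}) (rank_of M)"
  proof (rule base_polytope_bounded_bases)
    fix x A B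
    assume x: "x \<in> rank_polytope r n (Pow {1..n}) (rank_of M)"
      and AB: "A \<in> Pow {1..n}" "B \<in> Pow {1..n}"
      and tight: "weight x A = rank_of M A" "weight x B = rank_of M B"
    have "finite A" "finite B" using AB by (auto intro: finite_subset)
    then have "weight x (A \<union> B) + weight x (A \<inter> B) = weight x A + weight x B"
      by (rule weight_modular)
    moreover have "weight x (A \<union> B) \<le> rank_of M (A \<union> B)" "weight x (A \<inter> B) \<le> rank_of M (A \<inter> B)"
      using x AB by (auto simp: rank_polytope_def)
    \<comment> \<open>Uncrossing: the inequalities for union and intersection add up to an equality,
      so each is tight.\<close>
    ultimately show "A \<inter> B \<in> Pow {1..n} \<and> weight x (A \<inter> B) = rank_of M (A \<inter> B)"
      using rank_submodular[OF M, of A B] tight AB by auto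
  qed simp
  then show ?thesis unfolding bounded_bases_rank[OF M] .
qed

text \<open>Evaluating the indicator function of the polytope at 0/1 points therefore recovers the
  matroid.\<close>

lemma indicator_vec_in_base_polytope:
  assumes "M \<in> matroids r n" "B \<subseteq> {1..n}"
  shows "indicator_vec B \<in> base_polytope M \<longleftrightarrow> B \<in> M"
  using indicator_vec_in_rank_polytope[of "Pow {1..n}" n r "rank_of M"] assms
    base_polytope_matroid[OF assms(1)] bounded_bases_rank[OF assms(1)] by blast

section \<open>Decomposition into Schubert matroids\<close>

text \<open>Subtracting the weight from the rank gives a submodular function on the subsets of
  \<open>{1..n}\<close>; joining with a minimizer preserves the set of violated rank conditions.\<close>

lemma alternating_sum_violated:
  fixes x :: "nat \<Rightarrow>\<^sub>0 real"
  assumes M: "M \<in> matroids r n"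
  defines "V \<equiv> {A. A \<subseteq> {1..n} \<and> rank_of M A < weight x A}"
  shows "(\<Sum>D | D \<subseteq> V \<and> chain\<^sub>\<subseteq> D. (-1::int) ^ card D) = of_bool (V = {})"
proof (cases "V = {}")
  case True
  then have "{D. D \<subseteq> V \<and> chain\<^sub>\<subseteq> D} = {{}}" by (auto simp: chain_subset_def)
  with True show ?thesis by simp
next
  case False
  define f where "f A = real (rank_of M A) - weight x A" for A
  have V: "A \<in> V \<longleftrightarrow> A \<subseteq> {1..n} \<and> f A < 0" for A by (auto simp: V_def f_def)
  have finV: "finite V" by (rule finite_subset[of _ "Pow {1..n}"]) (auto simp: V_def)
  have "Min (f ` Pow {1..n}) \<in> f ` Pow {1..n}" by (intro Min_in) auto
  then obtain m where m: "m \<subseteq> {1..n}" and fm: "f m = Min (f ` Pow {1..n})" by auto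
  have min: "f m \<le> f A" if "A \<subseteq> {1..n}" for A unfolding fm using that by (intro Min_le) auto
  obtain A where "A \<in> V" using False by auto
  then have "m \<in> V" using m min[of A] by (simp add: V)
  \<comment> \<open>Submodularity bounds \<open>f (A \<union> m)\<close> by
    \<open>f A + f m - f (A \<inter> m)\<close>, and minimality of \<open>f m\<close> bounds this by
    \<open>f A\<close>, which is negative.\<close>
  have "A \<union> m \<in> V" if A: "A \<in> V" for A
  proof -
    have An: "A \<subseteq> {1..n}" using A V by simp
    then have "finite A" "finite m" using m by (auto intro: finite_subset)
    then have "f (A \<union> m) + f (A \<inter> m) \<le> f A + f m"
      using rank_submodular[OF M, of A m] weight_modular[of A m x] unfolding f_def by linarith
    moreover have "f m \<le> f (A \<inter> m)" using m by (intro min) auto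
    ultimately show ?thesis using A An m by (auto simp: V)
  qed
  then have "(\<Sum>D | D \<subseteq> V \<and> chain\<^sub>\<subseteq> D. (-1::int) ^ card D) = 0"
    by (rule alternating_sum_chains[OF finV \<open>m \<in> V\<close>])
  with False show ?thesis by simp
qed

definition subset_chains :: "nat \<Rightarrow> nat set set set" where
  "subset_chains n = {D. D \<subseteq> Pow {1..n} \<and> chain\<^sub>\<subseteq> D}"

lemma finite_subset_chains: "finite (subset_chains n)"
  by (rule finite_subset[of _ "Pow (Pow {1..n})"]) (auto simp: subset_chains_def)

lemma subset_chainsD:
  assumes "D \<in> subset_chains n" "E \<subseteq> D"
  shows "E \<subseteq> Pow {1..n}" "chain\<^sub>\<subseteq> E"
  using assms chain_subset_antimono[of D E] unfolding subset_chains_def by blast+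

text \<open>The inner sum is the expansion of the indicator of \<open>D \<subseteq> V\<close> for the set \<open>V\<close> of rank
  conditions violated by \<open>x\<close>.\<close>

lemma base_polytope_indicator:
  fixes x :: "nat \<Rightarrow>\<^sub>0 real"
  assumes M: "M \<in> matroids r n"
  shows "(indicator (base_polytope M) x :: int) = (\<Sum>D\<in>subset_chains n. (-1) ^ card D *
    (\<Sum>E\<in>Pow D. (-1) ^ card E * indicator (base_polytope (bounded_bases r n E (rank_of M))) x))"
proof (cases "x \<in> rank_polytope r n {} (rank_of M)")
  \<comment> \<open>Outside the hypersimplex all polytopes involved omit \<open>x\<close>, and both
    sides vanish.\<close>
  case False
  then have no: "x \<notin> rank_polytope r n \<F> (rank_of M)" for \<F>
    by (auto simp: rank_polytope_def)
  have "(\<Sum>E\<in>Pow D. (-1) ^ card E * indicator (base_polytope (bounded_bases r n E (rank_of M))) x) = (0::int)"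
    if D: "D \<in> subset_chains n" for D
    using no base_polytope_chain[OF subset_chainsD[OF D]] by (intro sum.neutral) auto
  moreover have "x \<notin> base_polytope M" using no base_polytope_matroid[OF M] by simp
  ultimately show ?thesis by simp
next
  case x: True
  define V where "V = {A. A \<subseteq> {1..n} \<and> rank_of M A < weight x A}"
  have inner: "(\<Sum>E\<in>Pow D. (-1) ^ card E * indicator (base_polytope (bounded_bases r n E (rank_of M))) x)
    = (of_bool (D \<subseteq> V) :: int)" if D: "D \<in> subset_chains n" for D
  proof -
    have finD: "finite D" using D by (auto simp: subset_chains_def intro: finite_subset)
    have ind: "indicator (base_polytope (bounded_bases r n E (rank_of M))) x
      = (of_bool (E \<subseteq> D - V) :: int)" if "E \<subseteq> D" for E
    proof -
      have "x \<in> rank_polytope r n E (rank_of M) \<longleftrightarrow> E \<subseteq> D - V"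
        using x that subset_chainsD(1)[OF D that] by (fastforce simp: rank_polytope_def V_def)
      then show ?thesis using base_polytope_chain[OF subset_chainsD[OF D that]]
        by (simp add: indicator_def)
    qed
    have "(\<Sum>E\<in>Pow D. (-1) ^ card E * indicator (base_polytope (bounded_bases r n E (rank_of M))) x)
      = (\<Sum>E\<in>Pow D. (-1) ^ card E * (of_bool (E \<subseteq> D - V) :: int))"
      by (intro sum.cong refl) (simp add: ind)
    \<comment> \<open>Only those \<open>E\<close> whose conditions all hold at \<open>x\<close>
      remain; their signed count is 1 if \<open>D - V\<close> is empty and 0 otherwise.\<close>
    also have "\<dots> = (\<Sum>E\<in>Pow (D - V). (-1) ^ card E)"
      using finD by (intro sum.mono_neutral_cong_right) auto
    also have "\<dots> = of_bool (D - V = {})" using finD by (intro alternating_sum_Pow) simp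
    finally show ?thesis by simp
  qed
  have "(\<Sum>D\<in>subset_chains n. (-1) ^ card D * of_bool (D \<subseteq> V))
    = (\<Sum>D | D \<subseteq> V \<and> chain\<^sub>\<subseteq> D. (-1::int) ^ card D)"
  proof (intro sum.mono_neutral_cong_right finite_subset_chains)
    show "{D. D \<subseteq> V \<and> chain\<^sub>\<subseteq> D} \<subseteq> subset_chains n" by (auto simp: V_def subset_chains_def)
  qed (auto simp: subset_chains_def)
  also have "\<dots> = of_bool (V = {})" unfolding V_def by (rule alternating_sum_violated[OF M])
  finally have "(\<Sum>D\<in>subset_chains n. (-1) ^ card D * of_bool (D \<subseteq> V)) = (of_bool (V = {}) :: int)" .
  moreover have "V = {} \<longleftrightarrow> (\<forall>A\<in>Pow {1..n}. weight x A \<le> rank_of M A)"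
    unfolding V_def by (auto simp: not_less)
  then have "V = {} \<longleftrightarrow> x \<in> base_polytope M"
    using x unfolding base_polytope_matroid[OF M] rank_polytope_def by simp
  ultimately show ?thesis by (simp add: inner indicator_def[of "base_polytope M" x])
qed

text \<open>The signed sum over pairs of chains is regrouped by the Schubert matroids occurring in
  it. Existence ensures that the choice in \<open>schubert_coeff\<close> yields actual
  coefficients.\<close>

lemma schubert_decomposition:
  assumes M: "M \<in> matroids r n"
  shows "\<exists>a. \<forall>x. (indicator (base_polytope M) x :: int) =
    (\<Sum>S\<in>schubert_matroids r n. a S * indicator (base_polytope S) x)"
proof -
  let ?N = "\<lambda>E. bounded_bases r n E (rank_of M)"
  let ?Sch = "schubert_matroids r n"
  \<comment> \<open>Different chains may cut out the same matroid, so the coefficient of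
    \<open>S\<close> collects the signs of all pairs \<open>D\<close>, \<open>E\<close> with
    \<open>S = ?N E\<close>.\<close>
  define a :: "bases \<Rightarrow> int" where
    "a S = (\<Sum>D\<in>subset_chains n. (-1) ^ card D * (\<Sum>E\<in>Pow D. (-1) ^ card E * of_bool (S = ?N E)))" for S
  have fin: "finite ?Sch"
    by (rule finite_subset[OF _ finite_matroids[of r n]]) (auto simp: schubert_matroids_def)
  have N: "?N E \<in> ?Sch" if "D \<in> subset_chains n" "E \<subseteq> D" for D E
  proof (rule bounded_bases_schubert[OF subset_chainsD[OF that]])
    obtain B where "B \<in> M" using M by (auto simp: matroids_def)
    then have "B \<in> ?N E"
      using matroid_basis[OF M] card_le_rank[OF M] by (auto simp: bounded_bases_def)
    then show "?N E \<noteq> {}" by auto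
  qed
  have "(\<Sum>S\<in>?Sch. a S * indicator (base_polytope S) x) = (indicator (base_polytope M) x :: int)" for x
  proof -
    have "(\<Sum>S\<in>?Sch. a S * indicator (base_polytope S) x)
      = (\<Sum>S\<in>?Sch. \<Sum>D\<in>subset_chains n. (-1) ^ card D *
          (\<Sum>E\<in>Pow D. (-1) ^ card E * (of_bool (S = ?N E) * indicator (base_polytope S) x)))"
      by (simp add: a_def sum_distrib_right sum_distrib_left mult.assoc)
    \<comment> \<open>The sum over \<open>S\<close> moves innermost, where
      \<open>of_bool (S = ?N E)\<close> selects a single term.\<close>
    also have "\<dots> = (\<Sum>D\<in>subset_chains n. (-1) ^ card D * (\<Sum>E\<in>Pow D. (-1) ^ card E *
          (\<Sum>S\<in>?Sch. of_bool (S = ?N E) * indicator (base_polytope S) x)))"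
      unfolding sum_distrib_left by (subst sum.swap) (intro sum.cong refl sum.swap)
    also have "\<dots> = (\<Sum>D\<in>subset_chains n. (-1) ^ card D * (\<Sum>E\<in>Pow D. (-1) ^ card E *
          indicator (base_polytope (?N E)) x))"
    proof (intro sum.cong refl arg_cong2[where f = "(*)"])
      fix D E assume "D \<in> subset_chains n" "E \<in> Pow D"
      then have "?N E \<in> ?Sch" using N by simp
      then show "(\<Sum>S\<in>?Sch. of_bool (S = ?N E) * indicator (base_polytope S) x)
        = (indicator (base_polytope (?N E)) x :: int)"
        using fin by (simp add: of_bool_def if_distrib[of "\<lambda>c. c * _"] cong: if_cong)
    qed
    also have "\<dots> = indicator (base_polytope M) x" by (rule base_polytope_indicator[OF M, symmetric])
    finally show ?thesis .
  qed
  then show ?thesis by metis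
qed

lemma schubert_coeff:
  assumes "M \<in> matroids r n"
  shows "indicator (base_polytope M) x =
    (\<Sum>S\<in>schubert_matroids r n. schubert_coeff r n M S * indicator (base_polytope S) x)"
  using someI_ex[OF schubert_decomposition[OF assms]] unfolding schubert_coeff_def by blast

section \<open>Vertices\<close>

text \<open>The open half-space below \<open>L p\<close> together with \<open>p\<close> is convex,
  so it contains the hull. Of two distinct hull points at least one then lies strictly below
  \<open>L p\<close>, and so does every point strictly between them.\<close>

lemma extreme_point_of_hull_unique_max:
  fixes L :: "'a::real_vector \<Rightarrow> real"
  assumes "linear L" "p \<in> P" and max: "\<And>q. q \<in> P \<Longrightarrow> q \<noteq> p \<Longrightarrow> L q < L p"
  shows "p extreme_point_of (convex hull P)"
proof -
  note L = linear_add[OF assms(1)] linear_scale[OF assms(1)]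
  have comb: "u * L a + v * L b < L p"
    if "L a \<le> L p" "L b \<le> L p" "L a < L p \<or> L b < L p" "0 < u" "0 < v" "u + v = 1" for a b u v
  proof -
    have "u * L a + v * L b < u * L p + v * L p"
      using that by (auto intro: add_less_le_mono add_le_less_mono)
    then show ?thesis using that by (simp flip: distrib_right)
  qed
  have "convex ({v. L v < L p} \<union> {p})"
  proof (rule convexI)
    fix a b u v
    assume a: "a \<in> {v. L v < L p} \<union> {p}" and b: "b \<in> {v. L v < L p} \<union> {p}"
      and uv: "0 \<le> u" "0 \<le> v" "u + v = (1::real)"
    consider "u = 0" | "v = 0" | "a = p" "b = p" | "0 < u" "0 < v" "L a < L p \<or> L b < L p"
      using a b uv by fastforce
    then show "u *\<^sub>R a + v *\<^sub>R b \<in> {v. L v < L p} \<union> {p}"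
    proof cases
      case 3
      then show ?thesis using uv by (simp flip: scaleR_left_distrib)
    next
      case 4
      then have "u * L a + v * L b < L p" using a b uv by (intro comb) auto
      then show ?thesis by (simp add: L)
    qed (use a b uv in auto)
  qed
  then have hull: "convex hull P \<subseteq> {v. L v < L p} \<union> {p}"
    using max by (intro hull_minimal) auto
  have "p \<notin> open_segment a b" if "a \<in> convex hull P" "b \<in> convex hull P" for a b
  proof
    assume "p \<in> open_segment a b"
    then obtain u where u: "a \<noteq> b" "0 < u" "u < 1" "p = (1 - u) *\<^sub>R a + u *\<^sub>R b"
      by (auto simp: in_segment)
    have "L a < L p \<or> a = p" "L b < L p \<or> b = p" using that hull by auto
    then have "L a < L p \<or> L b < L p" "L a \<le> L p" "L b \<le> L p" using u(1) by auto
    then have "(1 - u) * L a + u * L b < L p" using u(2,3) by (intro comb) auto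
    moreover have "L p = (1 - u) * L a + u * L b" by (subst u(4)) (simp add: L)
    ultimately show False by simp
  qed
  then show ?thesis using assms(2) by (auto simp: extreme_point_of_def intro: hull_inc)
qed

theorem theorem4p2:
  fixes r n :: nat and M :: bases
  assumes "r \<le> n" and "M \<in> matroids r n"
  shows "schubert_point r n M extreme_point_of Omega_polytope r n"
proof -
  let ?Sch = "schubert_matroids r n"
  let ?w = "\<lambda>B. if B \<in> M then 1 else - 1 :: real"
  \<comment> \<open>The inner sum evaluates at \<open>indicator_vec B\<close> the combination of
    Schubert indicators with coefficients \<open>v\<close>. For the point of a matroid this is the
    indicator of its own base polytope.\<close>
  define L where "L v = (\<Sum>B\<in>Pow {1..n}. ?w B *
    (\<Sum>S\<in>?Sch. Poly_Mapping.lookup v S * indicator (base_polytope S) (indicator_vec B)))"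
    for v :: "bases \<Rightarrow>\<^sub>0 real"
  have fin: "finite ?Sch"
    by (rule finite_subset[OF _ finite_matroids[of r n]]) (auto simp: schubert_matroids_def)
  have "linear L"
    by (rule linearI)
      (simp_all add: L_def lookup_add distrib_right distrib_left sum.distrib
        sum_distrib_left mult.assoc mult.left_commute)
  have L_point: "L (schubert_point r n N) = (\<Sum>B\<in>N. ?w B)" if N: "N \<in> matroids r n" for N
  proof -
    have "(\<Sum>S\<in>?Sch. Poly_Mapping.lookup (schubert_point r n N) S
        * indicator (base_polytope S) (indicator_vec B)) = (of_bool (B \<in> N) :: real)"
      if B: "B \<in> Pow {1..n}" for B
    proof -
      have "Poly_Mapping.lookup (schubert_point r n N) S = of_int (schubert_coeff r n N S)"
        if "S \<in> ?Sch" for S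
        using that fin by (simp add: schubert_point_def lookup_sum lookup_single when_def)
      then have "(\<Sum>S\<in>?Sch. Poly_Mapping.lookup (schubert_point r n N) S
          * indicator (base_polytope S) (indicator_vec B))
        = (of_int (\<Sum>S\<in>?Sch. schubert_coeff r n N S
          * indicator (base_polytope S) (indicator_vec B)) :: real)"
        by (simp add: indicator_def of_bool_def if_distrib cong: if_cong sum.cong)
      also have "\<dots> = of_int (indicator (base_polytope N) (indicator_vec B))"
        by (simp only: schubert_coeff[OF N])
      finally show ?thesis
        using B indicator_vec_in_base_polytope[OF N, of B] by (simp add: indicator_def)
    qed
    then have "L (schubert_point r n N) = (\<Sum>B\<in>Pow {1..n}. ?w B * of_bool (B \<in> N))"
      by (simp add: L_def)
    also have "\<dots> = (\<Sum>B\<in>N. ?w B)"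
      using N by (intro sum.mono_neutral_cong_right) (auto simp: matroids_def)
    finally show ?thesis .
  qed
  have less: "L (schubert_point r n N) < L (schubert_point r n M)"
    if N: "N \<in> matroids r n" "N \<noteq> M" for N
  proof -
    have f: "finite N" "finite M" using N assms(2) matroid_finite by auto
    have "(\<Sum>B\<in>N. ?w B) = real (card (N \<inter> M)) - real (card (N - M))"
      using f by (simp add: sum.If_cases Diff_eq)
    moreover have "(\<Sum>B\<in>M. ?w B) = real (card M)" by simp
    \<comment> \<open>As \<open>N \<noteq> M\<close>, either a basis of \<open>M\<close> is missing
      from \<open>N\<close>, losing a positive term, or \<open>N\<close> has an additional basis,
      contributing a negative one.\<close>
    moreover have "card (N \<inter> M) < card M \<or> card (N \<inter> M) \<le> card M \<and> 0 < card (N - M)"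
    proof (cases "M \<subseteq> N")
      case True
      then have "N - M \<noteq> {}" using N(2) by auto
      then show ?thesis using f by (auto simp: card_gt_0_iff intro: card_mono)
    next
      case False
      then have "N \<inter> M \<subset> M" by auto
      then show ?thesis using f by (simp add: psubset_card_mono)
    qed
    ultimately show ?thesis unfolding L_point[OF N(1)] L_point[OF assms(2)] by linarith
  qed
  show ?thesis unfolding Omega_polytope_def
  proof (rule extreme_point_of_hull_unique_max[OF \<open>linear L\<close>])
    show "schubert_point r n M \<in> schubert_point r n ` matroids r n" using assms(2) by simp
  \<comment> \<open>A point other than that of \<open>M\<close> comes from some
    \<open>N \<noteq> M\<close>, so \<open>less\<close> applies.\<close>
  qed (use less in fastforce)
qed

end
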